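(* Let $I_0$ and $I$ be scalar fields on $\Omega_{\rm inv}$ ($I_0$ the ideal indicator, $I$ the normalized indicator), let $\tau>0$ and $\varepsilon\ge0$, and suppose $\|I-I_0\|_\infty\le\varepsilon$. Consider a bottleneck matching of cost at most $\varepsilon$ between the zero-dimensional sublevel persistence diagrams $\mathcal{D}_0(I_0)$ and $\mathcal{D}_0(I)$. If a finite bar of $\mathcal{D}_0(I_0)$ has persistence $p_0$ satisfying $$p_0>\tau+2\varepsilon,$$ then it is matched to a bar of $\mathcal{D}_0(I)$ whose persistence is greater than $\tau$. Conversely, if a bar of $\mathcal{D}_0(I_0)$ has persistence below $\tau-2\varepsilon$, its matched bar in $\mathcal{D}_0(I)$ has persistence below $\tau$.
   Context: $\Omega_{\rm inv}\subset\mathbb{R}^2$ is a bounded imaging window. The normalized indicator $I:\Omega_{\rm inv}\to[0,1]$ is a scalar imaging field affinely rescaled to have minimum $0$ and maximum $1$. The ideal indicator is $I_0(x)=\Phi(\operatorname{dist}(x,D))$ for a closed set $D\subset\mathbb{R}^2$, where $\Phi$ is continuous and strictly decreasing on the relevant distance range with $\Phi(0)=1$. For a scalar field $f$, $\mathcal{D}_0(f)$ is the persistence diagram of the zero-dimensional homology (over $\mathbb{F}_2$) of the sublevel filtration $\{x\in\Omega_{\rm inv}:f(x)\le t\}$; it is a multiset of bars $[b,d)$, identified with points $(b,d)$, and the persistence of a finite bar is $d-b$. The fields are assumed to be tame, so that the diagrams have finitely many off-diagonal points. A bottleneck matching between two diagrams pairs each off-diagonal point of one either with an off-diagonal point of the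 other or with a point $(c,c)$ of the diagonal (and vice versa); its cost is the largest $\ell^\infty$-distance between paired points (essential bars, with $d=\infty$, are paired with each other and compared by birth). A bar paired with the diagonal is regarded as having a matched bar of persistence $0$. The bottleneck distance $d_B$ is the minimal cost, and the known bottleneck stability theorem states $d_B(\mathcal{D}_0(f),\mathcal{D}_0(g))\le\|f-g\|_\infty$, so a matching of cost at most $\varepsilon$ exists when $\|I-I_0\|_\infty\le\varepsilon$. *)

theory Defs
  imports "HOL-Analysis.Analysis" "HOL-Homology.Homology" "HOL-Library.Z2" "HOL-Library.Multiset"
begin

text \<open>
  Singular homology with coefficients in the two-element field \<^typ>\<open>bit\<close>, built on the
  library's singular simplices (the library's own chain groups have integer coefficients).
\<close>

type_synonym 'a chain_mod2 = "((nat \<Rightarrow> real) \<Rightarrow> 'a) \<Rightarrow>\<^sub>0 bit"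

definition chains_mod2 :: "nat \<Rightarrow> 'a topology \<Rightarrow> 'a chain_mod2 set" where
  "chains_mod2 p X = {c. Poly_Mapping.keys c \<subseteq> Collect (singular_simplex p X)}"

text \<open>Every nonzero coefficient is \<open>1\<close>, and the usual alternating signs are trivial mod 2.\<close>

definition boundary_mod2 :: "nat \<Rightarrow> 'a chain_mod2 \<Rightarrow> 'a chain_mod2" where
  "boundary_mod2 p c =
     (if p = 0 then 0
      else \<Sum>\<sigma>\<in>Poly_Mapping.keys c. \<Sum>k\<le>p. Poly_Mapping.single (singular_face p k \<sigma>) 1)"

definition cycles_mod2 :: "nat \<Rightarrow> 'a topology \<Rightarrow> 'a chain_mod2 set" where
  "cycles_mod2 p X = {c \<in> chains_mod2 p X. boundary_mod2 p c = 0}"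

definition boundaries_mod2 :: "nat \<Rightarrow> 'a topology \<Rightarrow> 'a chain_mod2 set" where
  "boundaries_mod2 p X = boundary_mod2 (Suc p) ` chains_mod2 (Suc p) X"

text \<open>
  The homology classes of the finite family \<open>z\<close>, indexed by \<open>J\<close>, form a basis of the \<open>p\<close>-th
  homology space, cycles modulo boundaries. Over the two-element field the linear combinations
  of a finite family are the sums over subsets \<open>K\<close> of the index set.
\<close>

definition homology_basis_mod2 ::
  "nat \<Rightarrow> 'a topology \<Rightarrow> 'i set \<Rightarrow> ('i \<Rightarrow> 'a chain_mod2) \<Rightarrow> bool" where
  "homology_basis_mod2 p X J z \<longleftrightarrow>
     finite J \<and> (\<forall>i\<in>J. z i \<in> cycles_mod2 p X) \<and>
     (\<forall>c\<in>cycles_mod2 p X. \<exists>!K. K \<subseteq> J \<and> c - (\<Sum>i\<in>K. z i) \<in> boundaries_mod2 p X)"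

definition sublevel_space :: "'a::topological_space set \<Rightarrow> ('a \<Rightarrow> real) \<Rightarrow> real \<Rightarrow> 'a topology" where
  "sublevel_space \<Omega> f t = top_of_set {x \<in> \<Omega>. f x \<le> t}"

text \<open>
  A point \<open>(b, d)\<close> stands for the bar \<open>[b, d)\<close>; a bar is essential if \<open>d = \<infinity>\<close>.
\<close>

type_synonym bar = "real \<times> ereal"

definition persistence :: "bar \<Rightarrow> ereal" where
  "persistence u = snd u - ereal (fst u)"

definition on_diagonal :: "bar \<Rightarrow> bool" where
  "on_diagonal u \<longleftrightarrow> snd u = ereal (fst u)"

text \<open>
  The finite multiset \<open>M\<close> is the persistence diagram of the degree-\<open>p\<close> homology of the sublevel
  filtration of \<open>f\<close>: the persistence module is the direct sum of the interval modules
  of the bars \<open>[b i, d i)\<close>. The class of \<open>z i\<close> is born at \<open>b i\<close>, vanishes from \<open>d i\<close> on,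
  and at each level the classes of the bars containing that level form a basis. The maps of the
  module are induced by inclusion, so they send the class of \<open>z i\<close> to the class of the same chain.
  As \<open>M\<close> is finite, the existence of such an \<open>M\<close> contains the tameness of \<open>f\<close>.
\<close>

definition has_persistence_diagram ::
  "nat \<Rightarrow> 'a::topological_space set \<Rightarrow> ('a \<Rightarrow> real) \<Rightarrow> bar multiset \<Rightarrow> bool" where
  "has_persistence_diagram p \<Omega> f M \<longleftrightarrow>
     (\<exists>(n::nat) b d z.
        M = image_mset (\<lambda>i. (b i, d i)) (mset_set {..<n}) \<and>
        (\<forall>i<n. ereal (b i) < d i \<and>
               z i \<in> cycles_mod2 p (sublevel_space \<Omega> f (b i)) \<and>
               (\<forall>t. d i \<le> ereal t \<longrightarrow> z i \<in> boundaries_mod2 p (sublevel_space \<Omega> f t))) \<and>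
        (\<forall>t. homology_basis_mod2 p (sublevel_space \<Omega> f t)
               {i. i < n \<and> b i \<le> t \<and> ereal t < d i} z))"

text \<open>
  The \<open>\<ell>\<^sup>\<infinity>\<close>-distance. Two infinite deaths agree (in \<^typ>\<open>ereal\<close>, \<open>\<infinity> - \<infinity> = \<infinity>\<close>); a finite and
  an infinite death are at distance \<open>\<infinity>\<close>.
\<close>

definition bar_dist :: "bar \<Rightarrow> bar \<Rightarrow> ereal" where
  "bar_dist u v =
     max (ereal \<bar>fst u - fst v\<bar>) (if snd u = \<infinity> \<and> snd v = \<infinity> then 0 else \<bar>snd u - snd v\<bar>)"

text \<open>
  A matching is a multiset of pairs, so that repeated bars may have different partners.
  Every off-diagonal point of either diagram is used exactly as often as it occurs there;
  its partner is an off-diagonal point of the other diagram or some point \<open>(c, c)\<close>, whose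
  persistence is \<open>0\<close>.
\<close>

definition diagram_matching :: "bar multiset \<Rightarrow> bar multiset \<Rightarrow> (bar \<times> bar) multiset \<Rightarrow> bool" where
  "diagram_matching A B \<mu> \<longleftrightarrow>
     filter_mset (\<lambda>u. \<not> on_diagonal u) (image_mset fst \<mu>) = A \<and>
     filter_mset (\<lambda>v. \<not> on_diagonal v) (image_mset snd \<mu>) = B \<and>
     (\<forall>(u, v)\<in>#\<mu>. \<not> (on_diagonal u \<and> on_diagonal v) \<and> (snd u = \<infinity> \<longleftrightarrow> snd v = \<infinity>))"

definition matching_cost :: "(bar \<times> bar) multiset \<Rightarrow> ereal" where
  "matching_cost \<mu> = Max (insert 0 ((\<lambda>(u, v). bar_dist u v) ` set_mset \<mu>))"

text \<open>
  The relevant distance range is the interval from \<open>0\<close> to the supremum of the distances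
  occurring in the window, that supremum included only if it is attained. The set \<open>D\<close> must be
  nonempty, since \<^term>\<open>infdist x {}\<close> is \<open>0\<close> by convention.
\<close>

definition distance_range :: "'a::metric_space set \<Rightarrow> 'a set \<Rightarrow> real set" where
  "distance_range \<Omega> D = {r. 0 \<le> r \<and> (\<exists>x\<in>\<Omega>. r \<le> infdist x D)}"

definition ideal_indicator ::
  "'a::metric_space set \<Rightarrow> 'a set \<Rightarrow> (real \<Rightarrow> real) \<Rightarrow> ('a \<Rightarrow> real) \<Rightarrow> bool" where
  "ideal_indicator \<Omega> D \<Phi> f \<longleftrightarrow>
     closed D \<and> D \<noteq> {} \<and>
     continuous_on (distance_range \<Omega> D) \<Phi> \<and>
     strict_antimono_on (distance_range \<Omega> D) \<Phi> \<and> \<Phi> 0 = 1 \<and>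
     (\<forall>x\<in>\<Omega>. f x = \<Phi> (infdist x D))"

definition normalized_indicator :: "'a set \<Rightarrow> ('a \<Rightarrow> real) \<Rightarrow> bool" where
  "normalized_indicator \<Omega> f \<longleftrightarrow>
     f ` \<Omega> \<subseteq> {0..1} \<and> (\<exists>x\<in>\<Omega>. f x = 0) \<and> (\<exists>x\<in>\<Omega>. f x = 1)"

definition sup_norm_on :: "'a set \<Rightarrow> ('a \<Rightarrow> real) \<Rightarrow> ereal" where
  "sup_norm_on \<Omega> f = (SUP x\<in>\<Omega>. ereal \<bar>f x\<bar>)"

end

theory Submission
  imports Defs
begin

text \<open>Persistence is death minus birth. A matching of cost at most \<epsilon> moves each
  coordinate of a finite bar by at most \<epsilon>, hence its persistence by at most 2 * \<epsilon>
  (\<open>persistence_diff_le_bar_dist\<close>); both claims are this estimate, read once in each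
  direction. For a long bar the partner's persistence exceeds \<tau> > 0, so the partner is off the
  diagonal and \<open>diagram_matching_partner\<close> makes it a genuine bar of the second diagram.
  The partner of a short bar may be a diagonal point.\<close>

lemma persistence_diff_le_bar_dist:
  assumes "bar_dist u v \<le> ereal \<epsilon>" and "\<bar>snd u\<bar> \<noteq> \<infinity>"
  shows "\<bar>persistence v - persistence u\<bar> \<le> ereal (2 * \<epsilon>)"
proof -
  obtain b d where u: "u = (b, ereal d)"
    using assms(2) by (cases u; cases "snd u") auto
  obtain b' e' where v: "v = (b', e')"
    by (cases v)
  have births: "\<bar>b - b'\<bar> \<le> \<epsilon>" and deaths: "\<bar>ereal d - e'\<bar> \<le> ereal \<epsilon>"
    using assms(1) by (auto simp: bar_dist_def u v)
  \<comment> \<open>An infinite \<open>e'\<close> would lie at distance \<infinity> from the finite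
    death \<open>d\<close>.\<close>
  obtain d' where e': "e' = ereal d'"
    using deaths by (cases e') auto
  show ?thesis
    using births deaths by (simp add: persistence_def u v e')
qed

lemma bar_dist_le_matching_cost:
  assumes "(u, v) \<in># \<mu>"
  shows "bar_dist u v \<le> matching_cost \<mu>"
  unfolding matching_cost_def using assms by (intro Max_ge) force+

lemma diagram_matching_total:
  assumes "diagram_matching A B \<mu>" and "u \<in># A"
  shows "\<exists>v. (u, v) \<in># \<mu>"
  using assms unfolding diagram_matching_def by force

text \<open>An off-diagonal second component survives the filter that recovers \<open>B\<close> from
  the matching.\<close>

lemma diagram_matching_partner:
  assumes "diagram_matching A B \<mu>" and "(u, v) \<in># \<mu>" and "\<not> on_diagonal v"
  shows "v \<in># B"
  using assms unfolding diagram_matching_def by force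

lemma persistence_on_diagonal: "on_diagonal v \<Longrightarrow> persistence v = 0"
  by (simp add: on_diagonal_def persistence_def)

lemma has_persistence_diagram_birth_less_death:
  assumes "has_persistence_diagram p \<Omega> f M" and "u \<in># M"
  shows "ereal (fst u) < snd u"
  using assms unfolding has_persistence_diagram_def by auto

theorem theorem3p5:
  fixes \<Omega> D :: "(real ^ 2) set"
    and \<Phi> :: "real \<Rightarrow> real"
    and I\<^sub>0 I :: "real ^ 2 \<Rightarrow> real"
    and \<tau> \<epsilon> :: real
    and D\<^sub>0 D\<^sub>1 :: "bar multiset"
    and \<mu> :: "(bar \<times> bar) multiset"
  assumes "bounded \<Omega>"
    and "ideal_indicator \<Omega> D \<Phi> I\<^sub>0"
    and "normalized_indicator \<Omega> I"
    and "\<tau> > 0" and "\<epsilon> \<ge> 0"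
    and "sup_norm_on \<Omega> (\<lambda>x. I x - I\<^sub>0 x) \<le> ereal \<epsilon>"
    and "has_persistence_diagram 0 \<Omega> I\<^sub>0 D\<^sub>0"
    and "has_persistence_diagram 0 \<Omega> I D\<^sub>1"
    and "diagram_matching D\<^sub>0 D\<^sub>1 \<mu>"
    and "matching_cost \<mu> \<le> ereal \<epsilon>"
  shows "(\<forall>u\<in>#D\<^sub>0. snd u \<noteq> \<infinity> \<and> persistence u > ereal (\<tau> + 2 * \<epsilon>) \<longrightarrow>
            (\<exists>v. (u, v) \<in># \<mu>) \<and>
            (\<forall>v. (u, v) \<in># \<mu> \<longrightarrow> v \<in># D\<^sub>1 \<and> persistence v > ereal \<tau>)) \<and>
         (\<forall>u\<in>#D\<^sub>0. persistence u < ereal (\<tau> - 2 * \<epsilon>) \<longrightarrow>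
            (\<exists>v. (u, v) \<in># \<mu>) \<and>
            (\<forall>v. (u, v) \<in># \<mu> \<longrightarrow> persistence v < ereal \<tau>))"
proof -
  \<comment> \<open>The type \<open>bar\<close> admits the death -\<infinity>; bars of a diagram
    have a death above their real birth, which excludes it.\<close>
  have death: "snd u \<noteq> - \<infinity>" if "u \<in># D\<^sub>0" for u
    using has_persistence_diagram_birth_less_death[OF assms(7) that] by auto
  have diff: "\<bar>persistence v - persistence u\<bar> \<le> ereal (2 * \<epsilon>)"
    if "u \<in># D\<^sub>0" "snd u \<noteq> \<infinity>" "(u, v) \<in># \<mu>" for u v
  proof (rule persistence_diff_le_bar_dist)
    show "bar_dist u v \<le> ereal \<epsilon>"
      using bar_dist_le_matching_cost[OF that(3)] assms(10) by (rule order_trans)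
    show "\<bar>snd u\<bar> \<noteq> \<infinity>"
      using death[OF that(1)] that(2) by (cases "snd u") auto
  qed
  have long: "v \<in># D\<^sub>1 \<and> persistence v > ereal \<tau>"
    if u: "u \<in># D\<^sub>0" "snd u \<noteq> \<infinity>" "persistence u > ereal (\<tau> + 2 * \<epsilon>)" and uv: "(u, v) \<in># \<mu>"
    for u v
  proof -
    have gt: "persistence v > ereal \<tau>"
      using diff[OF u(1,2) uv] u(3) by (cases "persistence u"; cases "persistence v") auto
    \<comment> \<open>Positivity of \<tau> enters here: a diagonal point has persistence 0.\<close>
    then have "\<not> on_diagonal v"
      using persistence_on_diagonal[of v] assms(4) by auto
    then show ?thesis
      using diagram_matching_partner[OF assms(9) uv] gt by blast
  qed
  have short: "persistence v < ereal \<tau>"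
    if u: "u \<in># D\<^sub>0" "persistence u < ereal (\<tau> - 2 * \<epsilon>)" and uv: "(u, v) \<in># \<mu>" for u v
  proof -
    \<comment> \<open>Finiteness comes from the upper bound itself, since an essential bar has
      infinite persistence.\<close>
    have "snd u \<noteq> \<infinity>"
      using u(2) by (auto simp: persistence_def)
    then show ?thesis
      using diff[OF u(1) _ uv] u(2) by (cases "persistence u"; cases "persistence v") auto
  qed
  show ?thesis
    using long short diagram_matching_total[OF assms(9)] by blast
qed

end
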